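(* Suppose there is an algorithm which takes as input a Diophantine equation and returns an integer, such that this integer is greater than the number of integer solutions of the equation whenever the set of integer solutions is finite. Then there is a computable strictly increasing function $g:\mathbb{N}\setminus\{0\}\to\mathbb{N}\setminus\{0\}$ such that $g$ majorizes $f$ (i.e. $f(n)\le g(n)$ for every positive integer $n$) and a finite-fold Diophantine representation of $g$ does not exist.
   Context: $\mathbb{N}$ denotes the set of non-negative integers. A Diophantine equation is an equation $D(x_1,\ldots,x_p)=0$ with $D\in\mathbb{Z}[x_1,\ldots,x_p]$ (for an arbitrary number $p$ of variables), given in a standard finite encoding; its integer solutions are the tuples in $\mathbb{Z}^p$ satisfying it. The algorithm in the hypothesis is assumed to halt on every Diophantine equation, including those with infinitely many integer solutions (for which nothing is required of the output). For a positive integer $n$, let $E_n=\{x_i=1,\ x_i+x_j=x_k,\ x_i\cdot x_j=x_k : i,j,k\in\{1,\ldots,n\}\}$, a finite set of equations in the variables $x_1,\ldots,x_n$ (the indices $i,j,k$ need not be distinct). A subsystem of $E_n$ is a subset $S\subseteq E_n$; its solutions are the tuples $(x_1,\ldots,x_n)\in\mathbb{Z}^n$ satisfying all equations in $S$. For a positive integer $n$, $f(n)$ denotes the greatest finite total number of solutions of a subsystem of $E_n$ in integers $x_1,\ldots,x_n$, i.e. the maximum of the number of integer solutions over all subsystems $S\subseteq E_n$ that have only finitely many integer solutions. A Diophantine representation of a set $\mathcal{M}\subseteq\mathbb{N}^k$ is given by an integer $m\ge 0$ and a polynomial $W(a_1,\ldots,a_k,x_1,\ldots,x_m)$ with integer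 coefficients such that for all $a_1,\ldots,a_k\in\mathbb{N}$: $(a_1,\ldots,a_k)\in\mathcal{M}$ if and only if there exist $x_1,\ldots,x_m\in\mathbb{N}$ with $W(a_1,\ldots,a_k,x_1,\ldots,x_m)=0$. The representation is finite-fold if for all $a_1,\ldots,a_k\in\mathbb{N}$ the equation $W(a_1,\ldots,a_k,x_1,\ldots,x_m)=0$ has only finitely many solutions $(x_1,\ldots,x_m)\in\mathbb{N}^m$. A (finite-fold) Diophantine representation of a function $g:\mathbb{N}\setminus\{0\}\to\mathbb{N}\setminus\{0\}$ means one of its graph $\{(n,g(n)) : n\in\mathbb{N}\setminus\{0\}\}\subseteq\mathbb{N}^2$. *)

theory Defs
  imports Complex_Main "HOL-Library.Nat_Bijection"
begin

section \<open>Partial recursive functions\<close>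

text \<open>
  "Algorithm" and "computable" refer to Kleene's partial recursive functions on natural numbers.
  A term of type \<open>recf\<close> is a program; \<open>rec_eval f xs y\<close> says that \<open>f\<close> halts on the argument
  tuple \<open>xs\<close> with output \<open>y\<close>. A program has no fixed arity; where a rule does not apply, it diverges.
\<close>

datatype recf =
    Zero
  | Succ
  | Proj nat
  | Comp recf "recf list"
  | PrimRec recf recf
  | Mu recf

inductive rec_eval :: "recf \<Rightarrow> nat list \<Rightarrow> nat \<Rightarrow> bool" where
  zero: "rec_eval Zero xs 0"
| succ: "rec_eval Succ [x] (Suc x)"
| proj: "i < length xs \<Longrightarrow> rec_eval (Proj i) xs (xs ! i)"
| comp: "length ys = length gs \<Longrightarrow> (\<And>i. i < length gs \<Longrightarrow> rec_eval (gs ! i) xs (ys ! i)) \<Longrightarrow>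
    rec_eval f ys z \<Longrightarrow> rec_eval (Comp f gs) xs z"
| primrec_0: "rec_eval f xs y \<Longrightarrow> rec_eval (PrimRec f g) (0 # xs) y"
| primrec_Suc: "rec_eval (PrimRec f g) (n # xs) y \<Longrightarrow> rec_eval g (n # y # xs) z \<Longrightarrow>
    rec_eval (PrimRec f g) (Suc n # xs) z"
| mu: "rec_eval f (n # xs) 0 \<Longrightarrow> (\<And>i. i < n \<Longrightarrow> \<exists>y>0. rec_eval f (i # xs) y) \<Longrightarrow>
    rec_eval (Mu f) xs n"

lemma rec_eval_deterministic:
  "rec_eval f xs y \<Longrightarrow> rec_eval f xs z \<Longrightarrow> y = z"
proof (induction arbitrary: z rule: rec_eval.induct)
  case (comp ys gs xs f w)
  from comp.prems obtain vs where vs: "length vs = length gs"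
    "\<And>i. i < length gs \<Longrightarrow> rec_eval (gs ! i) xs (vs ! i)" "rec_eval f vs z"
    by (cases rule: rec_eval.cases) blast
  have "ys = vs"
    using comp.hyps(1) vs(1,2) comp.IH(1) by (metis nth_equalityI)
  then show ?case using vs(3) comp.IH(2) by blast
next
  case (mu f n xs)
  from mu.prems have z: "rec_eval f (z # xs) 0" "\<And>i. i < z \<Longrightarrow> \<exists>y>0. rec_eval f (i # xs) y"
    by (cases rule: rec_eval.cases, blast)+
  show ?case
  proof (rule linorder_cases[of n z])
    assume "n < z"
    then show ?thesis using z(2) mu.IH(1) by (metis less_irrefl)
  next
    assume "z < n"
    then show ?thesis using z(1) mu.IH(2) by (metis less_irrefl)
  qed
next
  case zero
  then show ?case by (cases rule: rec_eval.cases) simp_all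
next
  case succ
  then show ?case by (cases rule: rec_eval.cases) simp_all
next
  case proj
  from proj.prems show ?case by (cases rule: rec_eval.cases) simp_all
next
  case primrec_0
  from primrec_0.prems show ?case
    by (cases rule: rec_eval.cases) (use primrec_0.IH in blast)
next
  case primrec_Suc
  from primrec_Suc.prems show ?case
    by (cases rule: rec_eval.cases) (use primrec_Suc.IH in blast)
qed

text \<open>A function on the positive integers is computable if some program computes it there.\<close>

definition computable_pos :: "(nat \<Rightarrow> nat) \<Rightarrow> bool" where
  "computable_pos g \<longleftrightarrow> (\<exists>r. \<forall>n>0. rec_eval r [n] (g n))"

section \<open>Polynomials and Diophantine equations\<close>

text \<open>
  A polynomial in \<open>\<int>[x\<^sub>0,\<dots>,x\<^bsub>p-1\<^esub>]\<close> is written as a list of terms, each a coefficient together with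
  an exponent vector of length \<open>p\<close>. Repeated exponent vectors and zero coefficients are allowed.
  Variables are numbered from 0 throughout, so that an assignment is a list.
\<close>

type_synonym poly_expr = "(int \<times> nat list) list"

definition poly_in :: "nat \<Rightarrow> poly_expr \<Rightarrow> bool" where
  "poly_in p D \<longleftrightarrow> (\<forall>(c, es) \<in> set D. length es = p)"

definition eval_poly :: "poly_expr \<Rightarrow> int list \<Rightarrow> int" where
  "eval_poly D xs = (\<Sum>(c, es)\<leftarrow>D. c * (\<Prod>i<length es. xs ! i ^ (es ! i)))"

definition int_solutions :: "nat \<Rightarrow> poly_expr \<Rightarrow> int list set" where
  "int_solutions p D = {xs. length xs = p \<and> eval_poly D xs = 0}"

text \<open>The code of the equation \<open>D = 0\<close> in \<open>p\<close> variables as a natural number.\<close>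

definition equation_code :: "nat \<Rightarrow> poly_expr \<Rightarrow> nat" where
  "equation_code p D =
     prod_encode (p, list_encode (map (\<lambda>(c, es). prod_encode (int_encode c, list_encode es)) D))"

section \<open>Subsystems of \<open>E\<^sub>n\<close>\<close>

text \<open>
  \<open>One i\<close>, \<open>Add i j k\<close> and \<open>Mult i j k\<close> stand for \<open>x\<^sub>i = 1\<close>, \<open>x\<^sub>i + x\<^sub>j = x\<^sub>k\<close> and \<open>x\<^sub>i \<cdot> x\<^sub>j = x\<^sub>k\<close>.
\<close>

datatype eqn = One nat | Add nat nat nat | Mult nat nat nat

definition E_sys :: "nat \<Rightarrow> eqn set" where
  "E_sys n = {One i | i. i < n}
       \<union> {Add i j k | i j k. i < n \<and> j < n \<and> k < n}
       \<union> {Mult i j k | i j k. i < n \<and> j < n \<and> k < n}"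

fun satisfies :: "int list \<Rightarrow> eqn \<Rightarrow> bool" where
  "satisfies xs (One i) \<longleftrightarrow> xs ! i = 1"
| "satisfies xs (Add i j k) \<longleftrightarrow> xs ! i + xs ! j = xs ! k"
| "satisfies xs (Mult i j k) \<longleftrightarrow> xs ! i * xs ! j = xs ! k"

definition system_solutions :: "nat \<Rightarrow> eqn set \<Rightarrow> int list set" where
  "system_solutions n S = {xs. length xs = n \<and> (\<forall>e\<in>S. satisfies xs e)}"

definition max_solutions :: "nat \<Rightarrow> nat" where
  "max_solutions n = Max {card (system_solutions n S) | S. S \<subseteq> E_sys n \<and> finite (system_solutions n S)}"

text \<open>
  The set under \<open>Max\<close> is finite and nonempty, so
  \<open>max_solutions n\<close> is a genuine maximum.
\<close>

lemma finite_E_sys: "finite (E_sys n)"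
proof -
  have "E_sys n \<subseteq> One ` {..<n} \<union> (\<lambda>(i, j, k). Add i j k) ` ({..<n} \<times> {..<n} \<times> {..<n})
      \<union> (\<lambda>(i, j, k). Mult i j k) ` ({..<n} \<times> {..<n} \<times> {..<n})"
    unfolding E_sys_def by (auto simp: image_iff)
  then show ?thesis by (rule finite_subset) auto
qed

lemma finite_max_solutions_set:
  "finite {card (system_solutions n S) | S. S \<subseteq> E_sys n \<and> finite (system_solutions n S)}"
  by (rule finite_subset[of _ "(\<lambda>S. card (system_solutions n S)) ` Pow (E_sys n)"])
    (auto simp: finite_E_sys)

lemma nonempty_max_solutions_set:
  "{card (system_solutions n S) | S. S \<subseteq> E_sys n \<and> finite (system_solutions n S)} \<noteq> {}"
proof -
  have "system_solutions n (One ` {..<n}) \<subseteq> {replicate n 1}"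
    by (auto simp: system_solutions_def intro: nth_equalityI)
  then have "finite (system_solutions n (One ` {..<n}))" by (rule finite_subset) simp
  moreover have "One ` {..<n} \<subseteq> E_sys n" by (auto simp: E_sys_def)
  ultimately show ?thesis by blast
qed

section \<open>Diophantine representations\<close>

definition nat_solutions :: "nat \<Rightarrow> poly_expr \<Rightarrow> nat list \<Rightarrow> nat list set" where
  "nat_solutions m W as = {xs. length xs = m \<and> eval_poly W (map int (as @ xs)) = 0}"

definition diophantine_rep :: "nat \<Rightarrow> nat list set \<Rightarrow> nat \<Rightarrow> poly_expr \<Rightarrow> bool" where
  "diophantine_rep k M m W \<longleftrightarrow> poly_in (k + m) W \<and>
     (\<forall>as. length as = k \<longrightarrow> (as \<in> M \<longleftrightarrow> (\<exists>xs. xs \<in> nat_solutions m W as)))"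

definition finite_fold_diophantine_rep ::
    "nat \<Rightarrow> nat list set \<Rightarrow> nat \<Rightarrow> poly_expr \<Rightarrow> bool" where
  "finite_fold_diophantine_rep k M m W \<longleftrightarrow> diophantine_rep k M m W \<and>
     (\<forall>as. length as = k \<longrightarrow> finite (nat_solutions m W as))"

definition graph_pos :: "(nat \<Rightarrow> nat) \<Rightarrow> nat list set" where
  "graph_pos g = {[n, g n] | n. n > 0}"

end

theory Submission
  imports Defs "HOL-Computational_Algebra.Primes"
begin

text \<open>
  Let \<open>A\<close> be the given algorithm, and measure an equation by the largest of its number of variables,
  number of terms, coefficients and exponents. Define \<open>g n\<close> as \<open>n\<close> plus the sum of the outputs of \<open>A\<close>
  on finitely many equations, including all those of size at most \<open>27 n\<^sup>3\<close>. Each subsystem of \<open>E\<^sub>n\<close> is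
  equivalent to such an equation, namely a sum of squares, so \<open>g\<close> majorizes \<open>f\<close>.

  Suppose \<open>W(n, y, x) = 0\<close> is a finite-fold representation of \<open>g\<close>. For fixed \<open>n\<close>, the system
  \<open>W(n, y, x) = 0, y = u + v\<close> in natural unknowns has finitely many, but at least \<open>g n + 1\<close>,
  solutions. Writing each unknown as a sum of four squares turns it into an equation over the
  integers with the same property. Its size is only quadratic in \<open>n\<close>, since \<open>n\<close> enters
  through the summand \<open>(x\<^sub>0 - n)\<^sup>2\<close> alone. So for large \<open>n\<close> it has more than \<open>g n\<close> solutions, while
  \<open>A\<close> bounds their number by at most \<open>g n\<close>.
\<close>

section \<open>Lagrange's four-square theorem\<close>

definition four_squares :: "int \<Rightarrow> bool" where
  "four_squares n \<longleftrightarrow> (\<exists>a b c d. n = a\<^sup>2 + b\<^sup>2 + c\<^sup>2 + d\<^sup>2)"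

text \<open>Norm of a quaternion times the conjugate of another. With these signs the last three
  roots vanish when the two quadruples agree, so they are divisible by \<open>m\<close> when the
  quadruples are congruent modulo \<open>m\<close>.\<close>

lemma Euler_four_squares:
  fixes a b c d p q r s :: int
  shows "(a\<^sup>2 + b\<^sup>2 + c\<^sup>2 + d\<^sup>2) * (p\<^sup>2 + q\<^sup>2 + r\<^sup>2 + s\<^sup>2) =
    (a*p + b*q + c*r + d*s)\<^sup>2 + (b*p - a*q + d*r - c*s)\<^sup>2
    + (c*p - a*r + b*s - d*q)\<^sup>2 + (d*p - a*s + c*q - b*r)\<^sup>2"
  by (simp add: power2_eq_square algebra_simps)

lemma four_squares_mult:
  assumes "four_squares m" "four_squares n"
  shows "four_squares (m * n)"
  using assms unfolding four_squares_def by (metis Euler_four_squares)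

lemma centered_residue:
  fixes m x :: int
  assumes "m > 0"
  obtains y k where "x = y + m * k" "\<bar>2 * y\<bar> \<le> m"
proof (cases "2 * (x mod m) \<le> m")
  case True
  then show ?thesis
    using assms by (intro that[of "x mod m" "x div m"]) auto
next
  case False
  moreover have "x mod m < m" "x = m * (x div m) + x mod m" using assms by auto
  ultimately show ?thesis
    by (intro that[of "x mod m - m" "x div m + 1"]) (auto simp: algebra_simps)
qed

text \<open>
  Reducing the four roots modulo \<open>m\<close> to absolute value at most \<open>m / 2\<close> gives a sum of squares
  \<open>m * m'\<close> with \<open>m' \<le> m\<close>. In Euler's identity for the product of the two sums, all four roots are then
  divisible by \<open>m\<close>. Both \<open>m' = 0\<close> and \<open>m' = m\<close> would force \<open>m dvd p\<close>, so no separate treatment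
  of even \<open>m\<close> is needed.
\<close>

lemma four_squares_descent:
  fixes m p :: int
  assumes p: "prime p" and m: "1 < m" "m < p" and mp: "four_squares (m * p)"
  shows "\<exists>m'. 0 < m' \<and> m' < m \<and> four_squares (m' * p)"
proof -
  have not_dvd: "\<not> m dvd p"
    using p m unfolding prime_int_iff by (metis less_le_not_le less_imp_le order_trans zero_le_one)
  obtain a b c d where x: "m * p = a\<^sup>2 + b\<^sup>2 + c\<^sup>2 + d\<^sup>2"
    using mp by (auto simp: four_squares_def)
  have m0: "m > 0" using m by simp
  obtain a' ka where a: "a = a' + m * ka" "\<bar>2 * a'\<bar> \<le> m" using centered_residue[OF m0] .
  obtain b' kb where b: "b = b' + m * kb" "\<bar>2 * b'\<bar> \<le> m" using centered_residue[OF m0] .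
  obtain c' kc where c: "c = c' + m * kc" "\<bar>2 * c'\<bar> \<le> m" using centered_residue[OF m0] .
  obtain d' kd where d: "d = d' + m * kd" "\<bar>2 * d'\<bar> \<le> m" using centered_residue[OF m0] .
  define N where "N = a'\<^sup>2 + b'\<^sup>2 + c'\<^sup>2 + d'\<^sup>2"
  \<comment> \<open>Expanding \<open>m * p\<close> by the four decompositions shows that
    \<open>N\<close> is a multiple of \<open>m\<close>; this is the explicit quotient. It yields
    \<open>diff\<close>, from which \<open>m dvd p\<close> is read off in both boundary
    cases.\<close>
  define m' where "m' = p - (2 * a' * ka + 2 * b' * kb + 2 * c' * kc + 2 * d' * kd)
      - m * (ka\<^sup>2 + kb\<^sup>2 + kc\<^sup>2 + kd\<^sup>2)"
  have m': "N = m * m'"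
    using x by (simp add: m'_def N_def a(1) b(1) c(1) d(1) power2_eq_square algebra_simps)
  have diff: "p = m' + (2 * a' * ka + 2 * b' * kb + 2 * c' * kc + 2 * d' * kd)
      + m * (ka\<^sup>2 + kb\<^sup>2 + kc\<^sup>2 + kd\<^sup>2)" by (simp add: m'_def)
  have sq: "4 * t\<^sup>2 \<le> m\<^sup>2" if "\<bar>2 * t\<bar> \<le> m" for t
    using power_mono[OF that, of 2] by (simp add: power_mult_distrib)
  have le: "4 * a'\<^sup>2 \<le> m\<^sup>2" "4 * b'\<^sup>2 \<le> m\<^sup>2" "4 * c'\<^sup>2 \<le> m\<^sup>2" "4 * d'\<^sup>2 \<le> m\<^sup>2"
    using a(2) b(2) c(2) d(2) sq by blast+
  have "0 \<le> N" by (simp add: N_def)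
  then have "0 \<le> m'" using m' m0 by (simp add: zero_le_mult_iff)
  have "m * m' \<le> m * m" using le m' by (simp add: N_def power2_eq_square)
  then have "m' \<le> m" using m0 by simp
  have "m' \<noteq> 0"
  proof
    assume "m' = 0"
    then have "N = 0" using m' by simp
    then have "a' = 0" "b' = 0" "c' = 0" "d' = 0" 
      unfolding N_def by (smt (verit) zero_le_power2 zero_eq_power2)+
    then have "p = m * (ka\<^sup>2 + kb\<^sup>2 + kc\<^sup>2 + kd\<^sup>2)" using diff \<open>m' = 0\<close> by simp
    then show False using not_dvd by simp
  qed
  have "m' \<noteq> m"
  proof
    assume "m' = m"
    then have "4 * a'\<^sup>2 + 4 * b'\<^sup>2 + 4 * c'\<^sup>2 + 4 * d'\<^sup>2 = 4 * m\<^sup>2"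
      using m' by (simp add: N_def power2_eq_square)
    \<comment> \<open>The total is maximal only if every bound in \<open>le\<close> is an equality.
      Then \<open>m\<close> divides each doubled root, hence every summand in
      \<open>diff\<close>.\<close>
    then have "(2 * a')\<^sup>2 = m\<^sup>2" "(2 * b')\<^sup>2 = m\<^sup>2" "(2 * c')\<^sup>2 = m\<^sup>2" "(2 * d')\<^sup>2 = m\<^sup>2"
      using le by (auto simp: power_mult_distrib)
    then have "m dvd 2 * a'" "m dvd 2 * b'" "m dvd 2 * c'" "m dvd 2 * d'"
      by (metis dvd_refl pow_divides_pow_iff pos2)+
    then have "m dvd p" unfolding diff \<open>m' = m\<close> by simp
    then show False using not_dvd by simp
  qed
  \<comment> \<open>The quotients by \<open>m\<close> of the four roots in Euler's identity:
    products of reduced roots cancel in \<open>f\<close>, \<open>g\<close>, \<open>h\<close> and add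
    up to \<open>N = m * m'\<close> in \<open>e\<close>.\<close>
  define e where "e = m' + ka * a' + kb * b' + kc * c' + kd * d'"
  define f where "f = kb * a' - ka * b' + kd * c' - kc * d'"
  define g where "g = kc * a' - ka * c' + kb * d' - kd * b'"
  define h where "h = kd * a' - ka * d' + kc * b' - kb * c'"
  have e: "a*a' + b*b' + c*c' + d*d' = m * e" 
  proof -
    have "a*a' + b*b' + c*c' + d*d' = N + m * (ka * a' + kb * b' + kc * c' + kd * d')"
      by (simp add: N_def a b c d power2_eq_square algebra_simps)
    then show ?thesis by (simp add: m' e_def algebra_simps)
  qed
  have fgh: "b*a' - a*b' + d*c' - c*d' = m * f" "c*a' - a*c' + b*d' - d*b' = m * g"
     "d*a' - a*d' + c*b' - b*c' = m * h"
    by (simp_all add: f_def g_def h_def a b c d algebra_simps)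
  have "(m * p) * (m * m') = (m * e)\<^sup>2 + (m * f)\<^sup>2 + (m * g)\<^sup>2 + (m * h)\<^sup>2"
    unfolding x m'[symmetric] N_def Euler_four_squares e fgh ..
  then have "(m * m) * (m' * p) = (m * m) * (e\<^sup>2 + f\<^sup>2 + g\<^sup>2 + h\<^sup>2)"
    by (simp add: power2_eq_square algebra_simps)
  then have "m' * p = e\<^sup>2 + f\<^sup>2 + g\<^sup>2 + h\<^sup>2" using m0 by simp
  then have "four_squares (m' * p)" by (auto simp: four_squares_def)
  then show ?thesis using \<open>m' \<noteq> 0\<close> \<open>0 \<le> m'\<close> \<open>m' \<le> m\<close> \<open>m' \<noteq> m\<close> 
    by (intro exI[of _ m']) auto
qed

section \<open>Primes as sums of four squares\<close>

text \<open>\<open>p\<close> divides \<open>a - b\<close> or \<open>a + b\<close>, and on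
  \<open>{0..h}\<close> both have absolute value at most \<open>2 * h\<close>, which is less than
  \<open>p\<close>.\<close>

lemma inj_on_square_mod_prime:
  fixes p h :: int
  assumes p: "prime p" "p = 2 * h + 1"
  shows "inj_on (\<lambda>a. a\<^sup>2 mod p) {0..h}"
proof (rule inj_onI)
  fix a b assume ab: "a \<in> {0..h}" "b \<in> {0..h}" "a\<^sup>2 mod p = b\<^sup>2 mod p"
  then have "p dvd a\<^sup>2 - b\<^sup>2" by (simp add: mod_eq_dvd_iff)
  then have "p dvd (a - b) * (a + b)" by (simp add: power2_eq_square algebra_simps)
  then consider "p dvd a - b" | "p dvd a + b" using p prime_dvd_mult_iff by blast
  then show "a = b"
  proof cases
    case 1
    show ?thesis
    proof (rule ccontr)
      assume "a \<noteq> b"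
      then have "\<bar>p\<bar> \<le> \<bar>a - b\<bar>" using 1 by (intro dvd_imp_le_int) auto
      then show False using ab p(2) by auto
    qed
  next
    case 2
    show ?thesis
    proof (rule ccontr)
      assume "a \<noteq> b"
      then have "\<bar>p\<bar> \<le> \<bar>a + b\<bar>" using 2 ab by (intro dvd_imp_le_int) auto
      then show False using ab p(2) by auto
    qed
  qed
qed

text \<open>Pigeonhole: \<open>h + 1\<close> squares and \<open>h + 1\<close> values
  \<open>- 1 - b\<^sup>2\<close> cannot be disjoint among \<open>2 * h + 1\<close> residues.\<close>

lemma odd_prime_dvd_sum_of_two_squares_plus_1:
  fixes p h :: int
  assumes p: "prime p" "p = 2 * h + 1"
  obtains a b where "p dvd a\<^sup>2 + b\<^sup>2 + 1" "0 \<le> a" "a \<le> h" "0 \<le> b" "b \<le> h"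
proof -
  have p0: "p > 0" using p(1) by (rule prime_gt_0_int)
  then have h: "h \<ge> 0" using p(2) by simp
  define A where "A = (\<lambda>a. a\<^sup>2 mod p) ` {0..h}"
  define B where "B = (\<lambda>b. (- 1 - b\<^sup>2) mod p) ` {0..h}"
  note inj = inj_on_square_mod_prime[OF p]
  have injB: "inj_on (\<lambda>b. (- 1 - b\<^sup>2) mod p) {0..h}"
  proof (rule inj_onI)
    fix a b assume ab: "a \<in> {0..h}" "b \<in> {0..h}" "(- 1 - a\<^sup>2) mod p = (- 1 - b\<^sup>2) mod p"
    then have "a\<^sup>2 mod p = b\<^sup>2 mod p"
      by (simp add: mod_eq_dvd_iff) (metis dvd_minus_iff minus_diff_eq)
    then show "a = b" using inj ab(1,2) by (auto dest: inj_onD)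
  qed
  have "A \<inter> B \<noteq> {}"
  proof
    assume "A \<inter> B = {}"
    then have "card (A \<union> B) = card A + card B"
      by (intro card_Un_disjoint) (auto simp: A_def B_def)
    also have "\<dots> = nat (2 * h + 2)"
      using h by (simp add: A_def B_def card_image[OF inj] card_image[OF injB])
    finally have "card (A \<union> B) = nat (p + 1)" using p(2) by simp
    moreover have "card (A \<union> B) \<le> card {0..<p}"
      using p0 by (intro card_mono) (auto simp: A_def B_def)
    ultimately show False using p0 by simp
  qed
  then obtain a b where ab: "a \<in> {0..h}" "b \<in> {0..h}" "a\<^sup>2 mod p = (- 1 - b\<^sup>2) mod p"
    unfolding A_def B_def by blast
  then have "p dvd a\<^sup>2 + b\<^sup>2 + 1" by (simp add: mod_eq_dvd_iff algebra_simps)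
  then show ?thesis using that ab by auto
qed

text \<open>Infinite descent on the multiplier \<open>m\<close>, ending at 1.\<close>

lemma four_squares_prime_aux:
  fixes p :: int
  assumes "prime p"
  shows "0 < m \<Longrightarrow> m < p \<Longrightarrow> four_squares (m * p) \<Longrightarrow> four_squares p"
proof (induction "nat m" arbitrary: m rule: less_induct)
  case less
  show ?case
  proof (cases "m = 1")
    case True
    then show ?thesis using less.prems by simp
  next
    case False
    then obtain m' where "0 < m'" "m' < m" "four_squares (m' * p)"
      using four_squares_descent[OF assms, of m] less.prems by auto
    then show ?thesis using less.hyps[of m'] less.prems by auto
  qed
qed

lemma four_squares_prime:
  fixes p :: int
  assumes p: "prime p"
  shows "four_squares p"
proof (cases "p = 2")
  case True
  then have "p = 1\<^sup>2 + 1\<^sup>2 + 0\<^sup>2 + 0\<^sup>2" by simp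
  then show ?thesis unfolding four_squares_def by blast
next
  case False
  have "p > 0" using p by (rule prime_gt_0_int)
  then have "odd p" using p False by (metis prime_ge_2_int prime_odd_int le_neq_trans)
  then obtain h where h: "p = 2 * h + 1" by (elim oddE)
  obtain a b where ab: "p dvd a\<^sup>2 + b\<^sup>2 + 1" "0 \<le> a" "a \<le> h" "0 \<le> b" "b \<le> h"
    using odd_prime_dvd_sum_of_two_squares_plus_1[OF p h] .
  then obtain m where m: "a\<^sup>2 + b\<^sup>2 + 1 = m * p" by (metis dvdE mult.commute)
  have "m * p > 0" using m by (smt (verit) zero_le_power2)
  then have "m > 0" using \<open>p > 0\<close> by (simp add: zero_less_mult_iff)
  \<comment> \<open>Roots of at most half of \<open>p\<close> keep the multiplier \<open>m\<close>
    below \<open>p\<close>, as the descent demands.\<close>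
  have "a\<^sup>2 \<le> h\<^sup>2" "b\<^sup>2 \<le> h\<^sup>2" using ab by (auto intro: power_mono)
  then have "m * p \<le> 2 * h\<^sup>2 + 1" using m by simp
  also have "\<dots> < p * p"
  proof -
    have "h > 0" using h prime_gt_1_int[OF p] by simp
    then have "h * h > 0" by simp
    then show ?thesis using \<open>h > 0\<close> unfolding h by (simp add: power2_eq_square algebra_simps add_pos_pos)
  qed
  finally have "m < p" using \<open>p > 0\<close> by simp
  have "m * p = a\<^sup>2 + b\<^sup>2 + 1\<^sup>2 + 0\<^sup>2" using m by simp
  then have "four_squares (m * p)" unfolding four_squares_def by blast
  then show ?thesis using four_squares_prime_aux[OF p] \<open>m > 0\<close> \<open>m < p\<close> by blast
qed

theorem Lagrange_four_squares: "four_squares (int n)"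
proof (induction n rule: prime_divisors_induct)
  case zero
  have "int 0 = 0\<^sup>2 + 0\<^sup>2 + 0\<^sup>2 + 0\<^sup>2" by simp
  then show ?case unfolding four_squares_def by blast
next
  case (unit n)
  then have "int n = 1\<^sup>2 + 0\<^sup>2 + 0\<^sup>2 + 0\<^sup>2" by simp
  then show ?case unfolding four_squares_def by blast
next
  case (factor p n)
  then show ?case using four_squares_mult[OF four_squares_prime] by simp
qed

section \<open>Computable functions\<close>

definition computable :: "nat \<Rightarrow> (nat list \<Rightarrow> nat) \<Rightarrow> bool" where
  "computable k f \<longleftrightarrow> (\<exists>r. \<forall>xs. length xs = k \<longrightarrow> rec_eval r xs (f xs))"

lemma computable_cong:
  assumes "computable k f" "\<And>xs. length xs = k \<Longrightarrow> f xs = g xs"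
  shows "computable k g"
  using assms unfolding computable_def by metis

lemma computable_compose:
  assumes "computable n f" "length gs = n" "\<And>g. g \<in> set gs \<Longrightarrow> computable k g"
  shows "computable k (\<lambda>xs. f (map (\<lambda>g. g xs) gs))"
proof -
  obtain r where r: "\<And>xs. length xs = n \<Longrightarrow> rec_eval r xs (f xs)"
    using assms(1) unfolding computable_def by blast
  obtain s where s: "\<And>g xs. g \<in> set gs \<Longrightarrow> length xs = k \<Longrightarrow> rec_eval (s g) xs (g xs)"
    using assms(3) unfolding computable_def by metis
  have "rec_eval (Comp r (map s gs)) xs (f (map (\<lambda>g. g xs) gs))" if "length xs = k" for xs
    by (rule rec_eval.comp[where ys = "map (\<lambda>g. g xs) gs"]) (use that assms(2) r s in auto)
  then show ?thesis unfolding computable_def by blast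
qed

lemma computable_nth: "i < k \<Longrightarrow> computable k (\<lambda>xs. xs ! i)"
  unfolding computable_def by (metis rec_eval.proj)

lemma computable_hd: "computable (Suc k) hd"
  by (rule computable_cong[OF computable_nth[of 0]]) (auto simp: hd_conv_nth simp flip: length_0_conv)

lemma computable_tl:
  assumes "computable k f"
  shows "computable (Suc k) (\<lambda>xs. f (tl xs))"
proof -
  have "computable (Suc k) (\<lambda>xs. f (map (\<lambda>g. g xs) (map (\<lambda>i xs. xs ! Suc i) [0..<k])))"
    by (rule computable_compose[OF assms]) (auto intro: computable_nth)
  then show ?thesis
  proof (rule computable_cong)
    fix xs :: "nat list" assume "length xs = Suc k"
    then have "map (\<lambda>g. g xs) (map (\<lambda>i xs. xs ! Suc i) [0..<k]) = tl xs"
      by (auto intro!: nth_equalityI simp: nth_tl)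
    then show "f (map (\<lambda>g. g xs) (map (\<lambda>i xs. xs ! Suc i) [0..<k])) = f (tl xs)" by simp
  qed
qed

lemma computable_const: "computable k (\<lambda>_. c)"
proof (induction c)
  case 0
  show ?case unfolding computable_def by (meson rec_eval.zero)
next
  case (Suc c)
  have "computable 1 (\<lambda>xs. Suc (hd xs))"
    unfolding computable_def by (rule exI[of _ Succ]) (auto simp: length_Suc_conv intro: rec_eval.succ)
  from computable_compose[OF this, of "[\<lambda>_. c]"] Suc show ?case by simp
qed

text \<open>The head of the longer list stands for a bound value, its tail for the surrounding
  arguments. Summation indices and recursion counters are passed to the closure rules in the same
  way.\<close>

lemma computable_let:
  assumes "computable k f" "computable (Suc k) (\<lambda>zs. G (hd zs) (tl zs))"
  shows "computable k (\<lambda>xs. G (f xs) xs)"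
proof -
  have "computable k (\<lambda>xs. (\<lambda>zs. G (hd zs) (tl zs)) (map (\<lambda>g. g xs) (f # map (\<lambda>i xs. xs ! i) [0..<k])))"
    by (rule computable_compose[OF assms(2)]) (auto intro: computable_nth assms(1))
  then show ?thesis
  proof (rule computable_cong)
    fix xs :: "nat list" assume "length xs = k"
    then have "map (\<lambda>g. g xs) (map (\<lambda>i xs. xs ! i) [0..<k]) = xs"
      by (auto intro!: nth_equalityI)
    then show "(\<lambda>zs. G (hd zs) (tl zs)) (map (\<lambda>g. g xs) (f # map (\<lambda>i xs. xs ! i) [0..<k])) = G (f xs) xs"
      by simp
  qed
qed

lemma computable_app1:
  assumes "computable (Suc 0) (\<lambda>xs. F (hd xs))" "computable k f"
  shows "computable k (\<lambda>xs. F (f xs))"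
  using computable_compose[OF assms(1), of "[f]"] assms(2) by simp

lemma computable_app2:
  assumes "computable (Suc (Suc 0)) (\<lambda>xs. F (hd xs) (hd (tl xs)))" "computable k f" "computable k g"
  shows "computable k (\<lambda>xs. F (f xs) (g xs))"
  using computable_compose[OF assms(1), of "[f, g]" k] assms(2,3) by auto

lemma computable_rec_nat:
  assumes "computable k n" "computable k f"
    "computable (Suc (Suc k)) (\<lambda>zs. G (hd zs) (hd (tl zs)) (tl (tl zs)))"
  shows "computable k (\<lambda>xs. rec_nat (f xs) (\<lambda>i y. G i y xs) (n xs))"
proof -
  obtain r where r: "\<And>xs. length xs = k \<Longrightarrow> rec_eval r xs (f xs)"
    using assms(2) unfolding computable_def by blast
  obtain s where s: "\<And>xs. length xs = Suc (Suc k) \<Longrightarrow>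
      rec_eval s xs (G (hd xs) (hd (tl xs)) (tl (tl xs)))"
    using assms(3) unfolding computable_def by blast
  have "rec_eval (PrimRec r s) (n # xs) (rec_nat (f xs) (\<lambda>i y. G i y xs) n)"
    if "length xs = k" for n xs
  proof (induction n)
    case 0
    then show ?case using r[OF that] by (simp add: rec_eval.primrec_0)
  next
    case (Suc n)
    show ?case
      using rec_eval.primrec_Suc[OF Suc] s[of "n # rec_nat (f xs) (\<lambda>i y. G i y xs) n # xs"] that
      by simp
  qed
  \<comment> \<open>\<open>PrimRec\<close> recurses on the head of its arguments;
    \<open>computable_let\<close> then puts the value of \<open>n\<close> there.\<close>
  then have "computable (Suc k) (\<lambda>zs. rec_nat (f (tl zs)) (\<lambda>i y. G i y (tl zs)) (hd zs))"
    unfolding computable_def by (intro exI[of _ "PrimRec r s"]) (auto simp: length_Suc_conv)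
  from computable_let[OF assms(1) this] show ?thesis .
qed

named_theorems computable_intros

lemmas [computable_intros] = computable_const computable_hd

section \<open>Arithmetic and case distinctions\<close>

lemma computable_plus [computable_intros]:
  assumes "computable k f" "computable k g"
  shows "computable k (\<lambda>xs. f xs + g xs)"
proof (rule computable_app2[OF _ assms])
  have "computable (Suc (Suc 0)) (\<lambda>xs. rec_nat (hd (tl xs)) (\<lambda>i y. Suc y) (hd xs))"
  proof (rule computable_rec_nat)
    have "computable (Suc 0) (\<lambda>xs. Suc (hd xs))"
      unfolding computable_def by (rule exI[of _ Succ]) (auto simp: length_Suc_conv intro: rec_eval.succ)
    then show "computable (Suc (Suc (Suc (Suc 0)))) (\<lambda>zs. Suc (hd (tl zs)))"
      by (rule computable_app1) (intro computable_tl computable_hd)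
  qed (intro computable_tl computable_hd)+
  moreover have "rec_nat a (\<lambda>i y. Suc y) b = b + a" for a b
    by (induction b) auto
  ultimately show "computable (Suc (Suc 0)) (\<lambda>xs. hd xs + hd (tl xs))" by simp
qed

lemma computable_Suc [computable_intros]:
  "computable k f \<Longrightarrow> computable k (\<lambda>xs. Suc (f xs))"
  using computable_plus[of k f "\<lambda>_. 1"] computable_const by simp

lemma computable_sum [computable_intros]:
  assumes "computable k n" "computable (Suc k) (\<lambda>zs. G (hd zs) (tl zs))"
  shows "computable k (\<lambda>xs. \<Sum>i<n xs. G i xs)"
proof -
  have "computable k (\<lambda>xs. rec_nat 0 (\<lambda>i y. y + G i xs) (n xs))"
  proof (rule computable_rec_nat)
    \<comment> \<open>The recursion passes counter, accumulator and arguments, while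
      \<open>G\<close> expects counter and arguments; the projections skip position 1.\<close>
    have "computable (Suc (Suc k))
        (\<lambda>xs. (\<lambda>zs. G (hd zs) (tl zs)) (map (\<lambda>g. g xs) ((\<lambda>xs. xs ! 0) # map (\<lambda>i xs. xs ! Suc (Suc i)) [0..<k])))"
      by (rule computable_compose[OF assms(2)]) (auto intro: computable_nth)
    then have "computable (Suc (Suc k)) (\<lambda>zs. G (hd zs) (tl (tl zs)))"
    proof (rule computable_cong)
      fix xs :: "nat list" assume "length xs = Suc (Suc k)"
      then have "map (\<lambda>g. g xs) (map (\<lambda>i xs. xs ! Suc (Suc i)) [0..<k]) = tl (tl xs)" "xs ! 0 = hd xs"
        by (auto intro!: nth_equalityI simp: nth_tl length_Suc_conv)
      then show "(\<lambda>zs. G (hd zs) (tl zs)) (map (\<lambda>g. g xs) ((\<lambda>xs. xs ! 0) # map (\<lambda>i xs. xs ! Suc (Suc i)) [0..<k]))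
        = G (hd xs) (tl (tl xs))"
        by simp
    qed
    then show "computable (Suc (Suc k)) (\<lambda>zs. hd (tl zs) + G (hd zs) (tl (tl zs)))"
      by (intro computable_plus computable_tl computable_hd)
  qed (intro assms computable_const)+
  moreover have "rec_nat 0 (\<lambda>i y. y + G i xs) m = (\<Sum>i<m. G i xs)" for m xs
    by (induction m) auto
  ultimately show ?thesis by simp
qed

lemma computable_mult [computable_intros]:
  assumes "computable k f" "computable k g"
  shows "computable k (\<lambda>xs. f xs * g xs)"
proof -
  have "computable k (\<lambda>xs. \<Sum>i<f xs. g xs)"
    by (intro computable_sum computable_tl assms)
  then show ?thesis by simp
qed

lemma computable_pred:
  assumes "computable k f"
  shows "computable k (\<lambda>xs. f xs - 1)"
proof -
  have "computable k (\<lambda>xs. rec_nat 0 (\<lambda>i y. i) (f xs))"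
    by (rule computable_rec_nat) (intro assms computable_const computable_hd)+
  moreover have "rec_nat 0 (\<lambda>i y. i) n = n - 1" for n by (cases n) auto
  ultimately show ?thesis by simp
qed

lemma computable_diff [computable_intros]:
  assumes "computable k f" "computable k g"
  shows "computable k (\<lambda>xs. f xs - g xs)"
proof -
  have "computable k (\<lambda>xs. rec_nat (f xs) (\<lambda>i y. y - 1) (g xs))"
    by (rule computable_rec_nat) (intro assms computable_pred computable_tl computable_hd)+
  moreover have "rec_nat a (\<lambda>i y. y - 1) b = a - b" for a b :: nat by (induction b) auto
  ultimately show ?thesis by simp
qed

lemma computable_if_zero:
  assumes "computable k f" "computable k g" "computable k h"
  shows "computable k (\<lambda>xs. if f xs = 0 then g xs else h xs)"
proof -
  \<comment> \<open>By truncated subtraction, \<open>1 - f xs\<close> is 1 exactly when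
    \<open>f xs\<close> is 0.\<close>
  have "computable k (\<lambda>xs. (1 - f xs) * g xs + (1 - (1 - f xs)) * h xs)"
    by (intro computable_intros assms)
  then show ?thesis by (rule computable_cong) auto
qed

lemma computable_if_eq [computable_intros]:
  assumes "computable k f" "computable k f'" "computable k g" "computable k h"
  shows "computable k (\<lambda>xs. if f xs = f' xs then g xs else h xs)"
proof -
  have "computable k (\<lambda>xs. if (f xs - f' xs) + (f' xs - f xs) = 0 then g xs else h xs)"
    by (intro computable_if_zero computable_intros assms)
  then show ?thesis by (rule computable_cong) auto
qed

section \<open>Codes of pairs and lists\<close>

lemma computable_prod_encode [computable_intros]:
  assumes "computable k f" "computable k g"
  shows "computable k (\<lambda>xs. prod_encode (f xs, g xs))"
proof -
  \<comment> \<open>The sum is the triangular number in the Cantor pairing function.\<close>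
  have "computable k (\<lambda>xs. (\<Sum>i<f xs + g xs. Suc i) + f xs)"
    by (intro computable_intros computable_tl assms)
  moreover have "(\<Sum>i<n. Suc i) = triangle n" for n by (induction n) auto
  ultimately show ?thesis by (simp add: prod_encode_def)
qed

text \<open>Expresses decoding through bounded sums of computable functions, so that it is computable.\<close>

lemma sum_prod_decode:
  fixes F :: "nat \<Rightarrow> nat \<Rightarrow> nat"
  shows "(\<Sum>a<Suc c. \<Sum>b<Suc c. if prod_encode (a, b) = c then F a b else 0) = case_prod F (prod_decode c)"
proof -
  obtain x y where xy: "prod_decode c = (x, y)" by fastforce
  then have c: "c = prod_encode (x, y)" by (metis prod_decode_inverse)
  have le: "x < Suc c" "y < Suc c"
    using le_prod_encode_1[of x y] le_prod_encode_2[of y x] c by auto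
  have "(\<Sum>a<Suc c. \<Sum>b<Suc c. if prod_encode (a, b) = c then F a b else 0)
      = (\<Sum>a<Suc c. \<Sum>b<Suc c. if b = y then if a = x then F a b else 0 else 0)"
    by (intro sum.cong refl) (auto simp: c)
  also have "\<dots> = (\<Sum>a<Suc c. if a = x then F a y else 0)"
    using le by (simp del: sum.lessThan_Suc)
  also have "\<dots> = F x y" using le by (simp del: sum.lessThan_Suc)
  finally show ?thesis by (simp add: xy)
qed

lemma computable_fst_prod_decode [computable_intros]:
  assumes "computable k f"
  shows "computable k (\<lambda>xs. fst (prod_decode (f xs)))"
proof (rule computable_app1[OF _ assms])
  have "computable (Suc 0)
     (\<lambda>xs. \<Sum>a<Suc (hd xs). \<Sum>b<Suc (hd xs). if prod_encode (a, b) = hd xs then a else 0)"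
    by (intro computable_intros computable_tl)
  then show "computable (Suc 0) (\<lambda>xs. fst (prod_decode (hd xs)))"
    unfolding sum_prod_decode by (simp add: case_prod_unfold)
qed

lemma computable_snd_prod_decode [computable_intros]:
  assumes "computable k f"
  shows "computable k (\<lambda>xs. snd (prod_decode (f xs)))"
proof (rule computable_app1[OF _ assms])
  have "computable (Suc 0)
     (\<lambda>xs. \<Sum>a<Suc (hd xs). \<Sum>b<Suc (hd xs). if prod_encode (a, b) = hd xs then b else 0)"
    by (intro computable_intros computable_tl)
  then show "computable (Suc 0) (\<lambda>xs. snd (prod_decode (hd xs)))"
    unfolding sum_prod_decode by (simp add: case_prod_unfold)
qed

lemma list_encode_tl:
  "list_encode (tl xs) = (if list_encode xs = 0 then 0 else snd (prod_decode (list_encode xs - 1)))"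
  by (cases xs) auto

text \<open>Iterating the tail makes dropping a primitive recursion on codes. The code 0 of the
  empty list is mapped to itself; subtracting 1 undoes the \<open>Suc\<close> in the code of a
  nonempty list.\<close>

lemma list_encode_drop:
  "list_encode (drop n xs) =
    rec_nat (list_encode xs) (\<lambda>_ y. if y = 0 then 0 else snd (prod_decode (y - 1))) n"
proof (induction n)
  case (Suc n)
  have "list_encode (drop (Suc n) xs) = list_encode (tl (drop n xs))"
    by (simp add: drop_Suc tl_drop)
  then show ?case by (simp add: list_encode_tl Suc)
qed simp

lemma computable_drop [computable_intros]:
  assumes "computable k n" "computable k f"
  shows "computable k (\<lambda>xs. list_encode (drop (n xs) (list_decode (f xs))))"
  unfolding list_encode_drop list_decode_inverse
  by (intro computable_rec_nat computable_intros computable_tl assms)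

lemma list_encode_eq_0_iff: "list_encode xs = 0 \<longleftrightarrow> xs = []"
  by (cases xs) auto

lemma length_le_list_encode: "length xs \<le> list_encode xs"
proof (induction xs)
  case (Cons x xs)
  then show ?case using le_prod_encode_2[of "list_encode xs" x] by simp
qed simp

text \<open>The length is the number of \<open>i\<close> for which dropping \<open>i\<close> entries
  leaves a nonempty list; since the code bounds the length, all such \<open>i\<close> lie below
  it.\<close>

lemma computable_length [computable_intros]:
  assumes "computable k f"
  shows "computable k (\<lambda>xs. length (list_decode (f xs)))"
proof -
  have "computable k (\<lambda>xs. \<Sum>i<f xs. if list_encode (drop i (list_decode (f xs))) = 0 then 0 else 1)"
    by (intro computable_intros computable_tl assms)
  moreover have "(\<Sum>i<n. if list_encode (drop i (list_decode n)) = 0 then 0 else 1)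
      = length (list_decode n)" for n
  proof -
    have "length (list_decode n) \<le> n" using length_le_list_encode[of "list_decode n"] by simp
    then have "{..<length (list_decode n)} = {i \<in> {..<n}. \<not> length (list_decode n) \<le> i}" by auto
    moreover have "(\<Sum>i<n. if list_encode (drop i (list_decode n)) = 0 then 0 else 1)
      = (\<Sum>i \<in> {i \<in> {..<n}. \<not> length (list_decode n) \<le> i}. 1)"
      by (subst sum.inter_filter) (auto simp: list_encode_eq_0_iff intro!: sum.cong)
    ultimately show ?thesis by (metis card_eq_sum card_lessThan)
  qed
  ultimately show ?thesis by simp
qed

section \<open>Codes of equations and their size\<close>

definition valid_code :: "nat \<Rightarrow> bool" where
  "valid_code c \<longleftrightarrow> (\<forall>t \<in> set (list_decode (snd (prod_decode c))).
     length (list_decode (snd (prod_decode t))) = fst (prod_decode c))"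

text \<open>The encodings are bijections, so every number decodes to a number of variables and a
  list of terms; only the lengths of the exponent vectors can be wrong.\<close>

lemma valid_code_iff: "valid_code c \<longleftrightarrow> (\<exists>p D. poly_in p D \<and> c = equation_code p D)"
proof
  assume v: "valid_code c"
  define p where "p = fst (prod_decode c)"
  define D where "D = map (\<lambda>t. (int_decode (fst (prod_decode t)), list_decode (snd (prod_decode t))))
     (list_decode (snd (prod_decode c)))"
  have "poly_in p D" using v by (auto simp: poly_in_def D_def valid_code_def p_def)
  moreover have "equation_code p D = c"
    by (simp add: equation_code_def D_def p_def comp_def)
  ultimately show "\<exists>p D. poly_in p D \<and> c = equation_code p D" by blast
next
  assume "\<exists>p D. poly_in p D \<and> c = equation_code p D"
  then show "valid_code c"
    by (fastforce simp: valid_code_def poly_in_def equation_code_def)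
qed

lemma computable_valid_code:
  assumes "computable k f" "computable k g" "computable k h"
  shows "computable k (\<lambda>xs. if valid_code (f xs) then g xs else h xs)"
proof -
  \<comment> \<open>Counts the exponent vectors of wrong length; entry \<open>i\<close> is read off
    the code of the list without its first \<open>i\<close> entries.\<close>
  define b where "b c = (\<Sum>i<length (list_decode (snd (prod_decode c))).
    if length (list_decode (snd (prod_decode (fst (prod_decode
        (list_encode (drop i (list_decode (snd (prod_decode c)))) - 1))))))
      = fst (prod_decode c) then 0 else 1 :: nat)" for c
  have hd: "fst (prod_decode (list_encode (drop i xs) - 1)) = xs ! i" if "i < length xs" for i xs
    using that by (simp flip: Cons_nth_drop_Suc)
  have "b c = 0 \<longleftrightarrow> valid_code c" for c
    by (auto simp: b_def valid_code_def hd[unfolded One_nat_def] all_set_conv_all_nth)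
  then have "valid_code (f xs) \<longleftrightarrow> b (f xs) = 0" for xs by simp
  moreover have "computable k (\<lambda>xs. b (f xs))"
    unfolding b_def by (intro computable_intros computable_tl assms)
  ultimately show ?thesis
    using computable_if_zero[of k "\<lambda>xs. b (f xs)"] assms by simp
qed

text \<open>By monotonicity of the encodings this dominates the codes of all equations of size at
  most \<open>N\<close>; \<open>2 * N\<close> bounds the codes of integers of absolute value at most
  \<open>N\<close>.\<close>

definition equation_code_bound :: "nat \<Rightarrow> nat" where
  "equation_code_bound N = prod_encode (N, list_encode
     (replicate N (prod_encode (2 * N, list_encode (replicate N N)))))"

lemma computable_list_encode_replicate [computable_intros]:
  assumes "computable k n" "computable k f"
  shows "computable k (\<lambda>xs. list_encode (replicate (n xs) (f xs)))"
proof -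
  have "computable k (\<lambda>xs. rec_nat 0 (\<lambda>_ y. Suc (prod_encode (f xs, y))) (n xs))"
    by (intro computable_rec_nat computable_intros computable_tl assms)
  moreover have "rec_nat 0 (\<lambda>_ y. Suc (prod_encode (a, y))) n = list_encode (replicate n a)" for a n
    by (induction n) auto
  ultimately show ?thesis by simp
qed

lemma computable_equation_code_bound [computable_intros]:
  assumes "computable k f"
  shows "computable k (\<lambda>xs. equation_code_bound (f xs))"
  unfolding equation_code_bound_def by (intro computable_intros assms)

lemma triangle_mono: "m \<le> n \<Longrightarrow> triangle m \<le> triangle n"
  by (induction rule: dec_induct) auto

lemma prod_encode_mono: "a \<le> a' \<Longrightarrow> b \<le> b' \<Longrightarrow> prod_encode (a, b) \<le> prod_encode (a', b')"
  by (auto simp: prod_encode_def intro!: add_mono triangle_mono)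

lemma list_encode_le_replicate:
  "length xs \<le> n \<Longrightarrow> (\<And>x. x \<in> set xs \<Longrightarrow> x \<le> M) \<Longrightarrow> list_encode xs \<le> list_encode (replicate n M)"
proof (induction xs arbitrary: n)
  case (Cons x xs)
  then obtain n' where "n = Suc n'" "length xs \<le> n'" by (cases n) auto
  then show ?case using Cons by (auto intro!: prod_encode_mono)
qed simp

lemma int_encode_le: "int_encode c \<le> 2 * nat \<bar>c\<bar>"
  by (auto simp: int_encode_def sum_encode_def)

lemma equation_code_bound_mono: "M \<le> N \<Longrightarrow> equation_code_bound M \<le> equation_code_bound N"
  unfolding equation_code_bound_def
  by (auto intro!: prod_encode_mono list_encode_le_replicate)

lemma equation_code_le_bound:
  assumes "poly_in p D" "p \<le> N" "length D \<le> N"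
    "\<And>c es. (c, es) \<in> set D \<Longrightarrow> \<bar>c\<bar> \<le> int N \<and> (\<forall>e\<in>set es. e \<le> N)"
  shows "equation_code p D \<le> equation_code_bound N"
  unfolding equation_code_def equation_code_bound_def
proof (intro prod_encode_mono assms list_encode_le_replicate)
  fix x assume "x \<in> set (map (\<lambda>(c, es). prod_encode (int_encode c, list_encode es)) D)"
  then obtain c es where x: "x = prod_encode (int_encode c, list_encode es)" "(c, es) \<in> set D" by auto
  have "int_encode c \<le> 2 * N" using assms(4)[OF x(2)] int_encode_le[of c] by linarith
  moreover have "list_encode es \<le> list_encode (replicate N N)"
    using assms(1,2) assms(4)[OF x(2)] x(2)
    by (intro list_encode_le_replicate) (auto simp: poly_in_def)
  ultimately show "x \<le> prod_encode (2 * N, list_encode (replicate N N))"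
    unfolding x(1) by (rule prod_encode_mono)
qed (use assms in auto)

text \<open>
  The program \<open>A\<close> may diverge on numbers that code no equation; these are replaced by 0, the code
  of the empty polynomial in no variables.
\<close>

lemma computable_sum_valid_codes:
  assumes A: "\<And>c. valid_code c \<Longrightarrow> rec_eval A [c] (a c)"
  shows "computable (Suc 0) (\<lambda>xs. hd xs +
    (\<Sum>c<Suc (equation_code_bound (27 * (hd xs * hd xs * hd xs))). a (if valid_code c then c else 0)))"
proof -
  have v0: "valid_code 0" by (simp add: valid_code_def prod_decode_def prod_decode_aux.simps)
  have "computable (Suc 0) (\<lambda>xs. if valid_code (hd xs) then hd xs else 0)"
    by (intro computable_valid_code computable_intros)
  then obtain r where r: "\<And>c. rec_eval r [c] (if valid_code c then c else 0)"
    unfolding computable_def by (metis length_0_conv length_Cons list.sel(1))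
  have Ar: "rec_eval (Comp A [r]) [c] (a (if valid_code c then c else 0))" for c
    by (rule rec_eval.comp[where ys = "[if valid_code c then c else 0]"]) (use r A v0 in auto)
  have "computable (Suc 0) (\<lambda>xs. a (if valid_code (hd xs) then hd xs else 0))"
    unfolding computable_def
  proof (intro exI[of _ "Comp A [r]"] allI impI)
    fix xs :: "nat list" assume "length xs = Suc 0"
    then obtain c where "xs = [c]" by (auto simp: length_Suc_conv)
    then show "rec_eval (Comp A [r]) xs (a (if valid_code (hd xs) then hd xs else 0))"
      using Ar[of c] by (simp only: list.sel)
  qed
  then have "computable (Suc (Suc 0)) (\<lambda>zs. a (if valid_code (hd zs) then hd zs else 0))"
    by (rule computable_app1) (rule computable_hd)
  then show ?thesis by (intro computable_intros)
qed

section \<open>Systems of equations as single equations\<close>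

text \<open>
  A monomial is represented here by the list of its variables with repetition, so that multiplying
  monomials is appending lists and no number of variables has to be fixed.
\<close>

definition eval_terms :: "(int \<times> nat list) list \<Rightarrow> (nat \<Rightarrow> int) \<Rightarrow> int" where
  "eval_terms T x = (\<Sum>(c, vs)\<leftarrow>T. c * (\<Prod>v\<leftarrow>vs. x v))"

lemma eval_terms_simps [simp]:
  "eval_terms [] x = 0"
  "eval_terms ((c, vs) # T) x = c * (\<Prod>v\<leftarrow>vs. x v) + eval_terms T x"
  "eval_terms (T @ U) x = eval_terms T x + eval_terms U x"
  by (simp_all add: eval_terms_def)

definition poly_of_terms :: "nat \<Rightarrow> (int \<times> nat list) list \<Rightarrow> poly_expr" where
  "poly_of_terms p T = map (\<lambda>(c, vs). (c, map (count_list vs) [0..<p])) T"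

lemma poly_in_poly_of_terms: "poly_in p (poly_of_terms p T)"
  by (auto simp: poly_in_def poly_of_terms_def)

lemma prod_power_count_list:
  fixes x :: "nat \<Rightarrow> int"
  shows "set vs \<subseteq> {..<p} \<Longrightarrow> (\<Prod>i<p. x i ^ count_list vs i) = (\<Prod>v\<leftarrow>vs. x v)"
proof (induction vs)
  case (Cons v vs)
  have "(\<Prod>i<p. x i ^ count_list (v # vs) i) = (\<Prod>i<p. (if v = i then x v else 1) * x i ^ count_list vs i)"
    by (intro prod.cong) auto
  also have "\<dots> = x v * (\<Prod>i<p. x i ^ count_list vs i)"
    using Cons.prems by (simp add: prod.distrib)
  finally show ?case using Cons by simp
qed simp

lemma eval_poly_of_terms:
  assumes "\<And>c vs. (c, vs) \<in> set T \<Longrightarrow> set vs \<subseteq> {..<p}"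
  shows "eval_poly (poly_of_terms p T) xs = eval_terms T ((!) xs)"
  using assms
proof (induction T)
  case (Cons t T)
  obtain c vs where t: "t = (c, vs)" by fastforce
  have "set vs \<subseteq> {..<p}" using Cons.prems[of c vs] t by simp
  then show ?case
    using Cons by (auto simp: t eval_poly_def poly_of_terms_def prod_power_count_list)
qed (simp add: eval_poly_def poly_of_terms_def)

definition terms_of_poly :: "poly_expr \<Rightarrow> (int \<times> nat list) list" where
  "terms_of_poly W = map (\<lambda>(c, es). (c, concat (map (\<lambda>i. replicate (es ! i) i) [0..<length es]))) W"

lemma terms_of_poly_vars:
  assumes "poly_in p W" "(c, vs) \<in> set (terms_of_poly W)"
  shows "set vs \<subseteq> {..<p}"
  using assms by (fastforce simp: terms_of_poly_def poly_in_def)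

lemma eval_terms_of_poly:
  assumes "poly_in p W" "\<And>i. i < p \<Longrightarrow> xs ! i = x i"
  shows "eval_terms (terms_of_poly W) x = eval_poly W xs"
proof -
  have *: "prod_list (map x (concat (map (\<lambda>i. replicate (es ! i) i) is)))
      = prod_list (map (\<lambda>i. x i ^ (es ! i)) is)" for es "is"
    by (induction "is") (auto simp: prod_list_replicate)
  have "prod_list (map x (concat (map (\<lambda>i. replicate (es ! i) i) [0..<length es])))
      = (\<Prod>i<length es. xs ! i ^ (es ! i))" if "length es = p" for es
    unfolding * using assms(2) that
    by (subst prod.distinct_set_conv_list[symmetric]) (auto simp: atLeast0LessThan)
  then have "map (\<lambda>(c, vs). c * (\<Prod>v\<leftarrow>vs. x v)) (terms_of_poly W)
      = map (\<lambda>(c, es). c * (\<Prod>i<length es. xs ! i ^ (es ! i))) W"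
    using assms(1) by (fastforce simp: terms_of_poly_def poly_in_def)
  then show ?thesis by (simp only: eval_terms_def eval_poly_def)
qed

definition mult_terms where
  "mult_terms T U = concat (map (\<lambda>(c, vs). map (\<lambda>(d, ws). (c * d, vs @ ws)) U) T)"

lemma eval_mult_terms: "eval_terms (mult_terms T U) x = eval_terms T x * eval_terms U x"
proof (induction T)
  case (Cons t T)
  have "eval_terms (map (\<lambda>(d, ws). (c * d, vs @ ws)) U) x = c * (\<Prod>v\<leftarrow>vs. x v) * eval_terms U x" for c vs
    by (induction U) (auto simp: algebra_simps)
  then show ?case using Cons by (cases t) (auto simp: mult_terms_def algebra_simps)
qed (simp add: mult_terms_def)

definition sum_squares where
  "sum_squares Ts = concat (map (\<lambda>T. mult_terms T T) Ts)"

lemma eval_sum_squares_eq_0_iff: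
  "eval_terms (sum_squares Ts) x = 0 \<longleftrightarrow> (\<forall>T\<in>set Ts. eval_terms T x = 0)"
proof -
  \<comment> \<open>Nonnegativity is carried through the induction so that a vanishing sum forces
    both summands to vanish.\<close>
  have "0 \<le> eval_terms (sum_squares Ts) x \<and> (eval_terms (sum_squares Ts) x = 0 \<longleftrightarrow> (\<forall>T\<in>set Ts. eval_terms T x = 0))"
  proof (induction Ts)
    case (Cons T Ts)
    have "eval_terms (sum_squares (T # Ts)) x = eval_terms T x * eval_terms T x + eval_terms (sum_squares Ts) x"
      by (simp add: sum_squares_def eval_mult_terms)
    then show ?case using Cons by (simp add: add_nonneg_eq_0_iff)
  qed (simp add: sum_squares_def)
  then show ?thesis ..
qed

section \<open>Size of term lists\<close>

text \<open>The term count has its own bound \<open>l\<close>, because a sum of squares lengthens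
  with the number of equations while its coefficient and degree bounds do not grow with it.\<close>

definition bounded_terms :: "nat \<Rightarrow> nat \<Rightarrow> nat \<Rightarrow> (int \<times> nat list) list \<Rightarrow> bool" where
  "bounded_terms p l N T \<longleftrightarrow> length T \<le> l \<and>
     (\<forall>(c, vs)\<in>set T. \<bar>c\<bar> \<le> int N \<and> length vs \<le> N \<and> set vs \<subseteq> {..<p})"

lemma bounded_terms_mono:
  "bounded_terms p l N T \<Longrightarrow> l \<le> l' \<Longrightarrow> N \<le> N' \<Longrightarrow> bounded_terms p l' N' T"
  by (fastforce simp: bounded_terms_def)

lemma bounded_terms_append:
  "bounded_terms p l N T \<Longrightarrow> bounded_terms p l' N U \<Longrightarrow> bounded_terms p (l + l') N (T @ U)"
  by (auto simp: bounded_terms_def)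

lemma bounded_terms_exists:
  assumes "\<And>c vs. (c, vs) \<in> set T \<Longrightarrow> set vs \<subseteq> {..<p}"
  shows "\<exists>N. bounded_terms p N N T"
  using assms
proof (induction T)
  case Nil
  show ?case by (auto simp: bounded_terms_def)
next
  case (Cons t T)
  obtain c vs where t: "t = (c, vs)" by fastforce
  obtain N where "bounded_terms p N N T" using Cons by auto
  then have "bounded_terms p (1 + N) (N + nat \<bar>c\<bar> + length vs) ([(c, vs)] @ T)"
    using Cons.prems[of c vs] by (intro bounded_terms_append) (auto simp: bounded_terms_def t)
  then have "bounded_terms p (1 + N + nat \<bar>c\<bar> + length vs) (1 + N + nat \<bar>c\<bar> + length vs) ([(c, vs)] @ T)"
    by (rule bounded_terms_mono) auto
  then show ?case by (auto simp: t)
qed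

text \<open>Coefficients multiply and degrees add; \<open>N * M + N + M\<close> covers both.\<close>

lemma bounded_mult_terms:
  assumes "bounded_terms p l N T" "bounded_terms p l' M U"
  shows "bounded_terms p (l * l') (N * M + N + M) (mult_terms T U)"
proof -
  have "length (mult_terms T U) = length T * length U"
    unfolding mult_terms_def by (induction T) auto
  moreover have "\<bar>c * d\<bar> \<le> int N * int M" if "\<bar>c\<bar> \<le> int N" "\<bar>d\<bar> \<le> int M" for c d
    using that by (auto simp: abs_mult intro: mult_mono)
  ultimately show ?thesis using assms
    unfolding bounded_terms_def by (fastforce simp: mult_terms_def intro: mult_le_mono)
qed

lemma bounded_sum_squares:
  assumes "\<And>T. T \<in> set Ts \<Longrightarrow> bounded_terms p l N T"
  shows "bounded_terms p (length Ts * (l * l)) (N * N + N + N) (sum_squares Ts)"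
  using assms
proof (induction Ts)
  case (Cons T Ts)
  then have "bounded_terms p (l * l + length Ts * (l * l)) (N * N + N + N) (mult_terms T T @ sum_squares Ts)"
    by (intro bounded_terms_append bounded_mult_terms) auto
  then show ?case by (simp add: sum_squares_def)
qed (simp add: sum_squares_def bounded_terms_def)

lemma equation_code_poly_of_terms_le:
  assumes "bounded_terms p N N T" "p \<le> N"
  shows "equation_code p (poly_of_terms p T) \<le> equation_code_bound N"
proof (rule equation_code_le_bound)
  fix c es assume "(c, es) \<in> set (poly_of_terms p T)"
  then obtain vs where vs: "(c, vs) \<in> set T" "es = map (count_list vs) [0..<p]"
    by (auto simp: poly_of_terms_def)
  have "count_list vs i \<le> N" for i
    using count_le_length[of vs i] vs(1) assms(1) by (force simp: bounded_terms_def)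
  then show "\<bar>c\<bar> \<le> int N \<and> (\<forall>e\<in>set es. e \<le> N)"
    using assms(1) vs by (auto simp: bounded_terms_def)
qed (use assms poly_in_poly_of_terms in \<open>auto simp: bounded_terms_def poly_of_terms_def\<close>)

section \<open>Subsystems of \<open>E_sys n\<close> as single equations\<close>

fun eqn_terms :: "eqn \<Rightarrow> (int \<times> nat list) list" where
  "eqn_terms (One i) = [(1, [i]), (- 1, [])]"
| "eqn_terms (Add i j k) = [(1, [i]), (1, [j]), (- 1, [k])]"
| "eqn_terms (Mult i j k) = [(1, [i, j]), (- 1, [k])]"

lemma eval_eqn_terms: "eval_terms (eqn_terms e) ((!) xs) = 0 \<longleftrightarrow> satisfies xs e"
  by (cases e) auto

lemma card_E_sys_le: "card (E_sys n) \<le> n + 2 * (n * n * n)"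
proof -
  let ?A = "One ` {..<n}" and ?B = "(\<lambda>(i, j, k). Add i j k) ` ({..<n} \<times> {..<n} \<times> {..<n})"
    and ?C = "(\<lambda>(i, j, k). Mult i j k) ` ({..<n} \<times> {..<n} \<times> {..<n})"
  have "E_sys n \<subseteq> (?A \<union> ?B) \<union> ?C"
    unfolding E_sys_def by (auto simp: image_iff)
  then have "card (E_sys n) \<le> card ((?A \<union> ?B) \<union> ?C)" by (rule card_mono[rotated]) auto
  also have "\<dots> \<le> card ?A + card ?B + card ?C"
    by (meson add_le_mono1 card_Un_le order_trans)
  also have "\<dots> \<le> n + n * (n * n) + n * (n * n)"
    by (intro add_mono order_trans[OF card_image_le]) auto
  finally show ?thesis by (simp add: algebra_simps)
qed

lemma subsystem_as_equation:
  assumes "S \<subseteq> E_sys n" "n > 0"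
  obtains D where "poly_in n D" "int_solutions n D = system_solutions n S"
    "equation_code n D \<le> equation_code_bound (27 * (n * n * n))"
proof -
  have "finite S" using assms(1) finite_E_sys finite_subset by blast
  then obtain es where es: "set es = S" "distinct es" using finite_distinct_list by blast
  define T where "T = sum_squares (map eqn_terms es)"
  have n3: "n \<le> n * n * n" "1 \<le> n * n * n" using assms(2) by simp_all
  have "length es = card S" using es distinct_card by metis
  also have "\<dots> \<le> card (E_sys n)" using assms(1) finite_E_sys by (rule card_mono[rotated])
  finally have len: "length es \<le> 3 * (n * n * n)" using card_E_sys_le[of n] n3 by linarith
  have "bounded_terms n 3 2 (eqn_terms e)" if "e \<in> set es" for e
  proof -
    have "e \<in> E_sys n" using that es(1) assms(1) by blast
    then show ?thesis by (auto simp: bounded_terms_def E_sys_def)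
  qed
  \<comment> \<open>Origin of the constant 27: at most \<open>3 * (n * n * n)\<close> equations,
    each with at most 3 terms and so at most 9 after squaring.\<close>
  then have "bounded_terms n (length es * (3 * 3)) (2 * 2 + 2 + 2) T"
    using bounded_sum_squares[of "map eqn_terms es" n 3 2] by (auto simp: T_def)
  then have bounded: "bounded_terms n (27 * (n * n * n)) (27 * (n * n * n)) T"
    by (rule bounded_terms_mono) (use len n3 in linarith)+
  have "int_solutions n (poly_of_terms n T) = system_solutions n S"
  proof -
    have "eval_poly (poly_of_terms n T) xs = eval_terms T ((!) xs)" for xs
      using bounded by (intro eval_poly_of_terms) (auto simp: bounded_terms_def)
    then show ?thesis
      unfolding int_solutions_def system_solutions_def T_def eval_sum_squares_eq_0_iff
      by (auto simp: T_def eval_sum_squares_eq_0_iff eval_eqn_terms es(1))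
  qed
  moreover have "equation_code n (poly_of_terms n T) \<le> equation_code_bound (27 * (n * n * n))"
    using bounded n3 by (intro equation_code_poly_of_terms_le) auto
  ultimately show ?thesis using that poly_in_poly_of_terms by blast
qed

section \<open>Finite-fold representations\<close>

text \<open>
  The unknowns \<open>x\<^sub>0, \<dots>, x\<^bsub>K-1\<^esub>\<close> are to be natural; the four roots belonging to \<open>x\<^sub>i\<close> are
  the variables \<open>x\<^bsub>K+4i\<^esub>, \<dots>, x\<^bsub>K+4i+3\<^esub>\<close>.
\<close>

definition natural_terms :: "nat \<Rightarrow> nat \<Rightarrow> (int \<times> nat list) list" where
  "natural_terms K i = (1, [i]) # map (\<lambda>r. (- 1, [K + 4 * i + r, K + 4 * i + r])) [0..<4]"

lemma eval_natural_terms: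
  "eval_terms (natural_terms K i) x = 0 \<longleftrightarrow> x i = (\<Sum>r<4. x (K + 4 * i + r) * x (K + 4 * i + r))"
  by (auto simp: natural_terms_def numeral_eq_Suc)

lemma sum_squares_vars:
  assumes "(c, vs) \<in> set (sum_squares Ts)"
    and "\<And>U d us. U \<in> set Ts \<Longrightarrow> (d, us) \<in> set U \<Longrightarrow> set us \<subseteq> A"
  shows "set vs \<subseteq> A"
proof -
  obtain U where U: "U \<in> set Ts" "(c, vs) \<in> set (mult_terms U U)"
    using assms(1) by (auto simp: sum_squares_def)
  then obtain d us e ws where "(d, us) \<in> set U" "(e, ws) \<in> set U" "vs = us @ ws"
    by (auto simp: mult_terms_def)
  then show ?thesis using U(1) assms(2) by auto
qed

lemma four_squares_choice:
  obtains q :: "nat \<Rightarrow> nat \<Rightarrow> int" where "\<And>v. int v = (\<Sum>r<4. q v r * q v r)"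
proof -
  have "\<exists>s :: nat \<Rightarrow> int. int v = (\<Sum>r<4. s r * s r)" for v
  proof -
    obtain a b c d where "int v = a\<^sup>2 + b\<^sup>2 + c\<^sup>2 + d\<^sup>2"
      using Lagrange_four_squares[of v] by (auto simp: four_squares_def)
    then have "int v = (\<Sum>r<4. [a, b, c, d] ! r * [a, b, c, d] ! r)"
      by (simp add: numeral_eq_Suc)
    then show ?thesis by blast
  qed
  then show ?thesis using that by metis
qed

text \<open>\<open>N\<close> is fixed before \<open>n\<close>. This uniformity lets a size quadratic
  in \<open>n\<close> fall below the cubic size covered by the function of the theorem.\<close>

lemma equations_with_more_solutions_than_represented_value:
  assumes ff: "finite_fold_diophantine_rep 2 (graph_pos g) m W"
  obtains N where "\<And>n. n > 0 \<Longrightarrow> \<exists>p D. poly_in p D \<and> finite (int_solutions p D) \<and>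
    g n < card (int_solutions p D) \<and> equation_code p D \<le> equation_code_bound (n * n + n + n + N)"
proof -
  \<comment> \<open>\<open>x\<^sub>0\<close> is \<open>n\<close>, \<open>x\<^sub>1\<close> its value, then come the \<open>m\<close> unknowns of \<open>W\<close>, and \<open>x\<^bsub>m+2\<^esub> + x\<^bsub>m+3\<^esub> = x\<^sub>1\<close>.\<close>
  define K where "K = m + 4"
  \<comment> \<open>The \<open>K\<close> unknowns and four roots for each of them.\<close>
  define p where "p = 5 * K"
  have W: "poly_in (2 + m) W" and fin: "\<And>as. length as = 2 \<Longrightarrow> finite (nat_solutions m W as)"
    and rep: "\<And>as. length as = 2 \<Longrightarrow> as \<in> graph_pos g \<longleftrightarrow> (\<exists>xs. xs \<in> nat_solutions m W as)"
    using ff by (auto simp: finite_fold_diophantine_rep_def diophantine_rep_def)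
  \<comment> \<open>Collects the equations in which \<open>n\<close> does not occur, so that one
    bound serves all \<open>n\<close>.\<close>
  define R where "R = sum_squares (terms_of_poly W # [(1, [1]), (- 1, [m + 2]), (- 1, [m + 3])]
    # map (natural_terms K) [0..<K])"
  define T where "T n = sum_squares [[(1, [0]), (- int n, [])]] @ R" for n
  have T_0: "eval_terms (T n) x = 0 \<longleftrightarrow> x 0 = int n \<and> eval_terms (terms_of_poly W) x = 0 \<and>
    x 1 = x (m + 2) + x (m + 3) \<and> (\<forall>i<K. x i = (\<Sum>r<4. x (K + 4 * i + r) * x (K + 4 * i + r)))"
    for n x
  proof -
    have "T n = sum_squares ([(1, [0]), (- int n, [])] # terms_of_poly W # [(1, [1]), (- 1, [m + 2]), (- 1, [m + 3])]
      # map (natural_terms K) [0..<K])" by (simp add: T_def R_def sum_squares_def)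
    then show ?thesis
      by (auto simp: eval_sum_squares_eq_0_iff eval_natural_terms)
  qed
  have "set vs \<subseteq> {..<p}" if "(c, vs) \<in> set R" for c vs
    using that unfolding R_def
  proof (rule sum_squares_vars)
    fix U d us assume U: "U \<in> set (terms_of_poly W # [(1, [1]), (- 1, [m + 2]), (- 1, [m + 3])]
      # map (natural_terms K) [0..<K])" "(d, us) \<in> set U"
    then consider "U = terms_of_poly W" | "U = [(1, [1]), (- 1, [m + 2]), (- 1, [m + 3])]"
        | i where "i < K" "U = natural_terms K i" by auto
    then show "set us \<subseteq> {..<p}"
    proof cases
      case 1
      then show ?thesis using terms_of_poly_vars[OF W] U(2) by (fastforce simp: p_def K_def)
    qed (use U(2) in \<open>auto simp: p_def K_def natural_terms_def\<close>)
  qed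
  then obtain N where N: "bounded_terms p N N R" using bounded_terms_exists by blast
  have "poly_in p (poly_of_terms p (T n)) \<and> finite (int_solutions p (poly_of_terms p (T n))) \<and>
      g n < card (int_solutions p (poly_of_terms p (T n))) \<and>
      equation_code p (poly_of_terms p (T n)) \<le> equation_code_bound (n * n + n + n + (p + N + 4))" (is "_ \<and> finite ?S \<and> _")
    if n: "n > 0" for n
  proof -
    have "bounded_terms p 2 n [(1, [0]), (- int n, [])]"
      using n by (auto simp: bounded_terms_def p_def K_def)
    then have "bounded_terms p (length [[(1 :: int, [0 :: nat]), (- int n, [])]] * (2 * 2)) (n * n + n + n)
       (sum_squares [[(1, [0]), (- int n, [])]])"
      by (intro bounded_sum_squares) auto
    then have "bounded_terms p (4 + N) (n * n + n + n + N) (T n)"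
      unfolding T_def using N by (intro bounded_terms_append) (auto elim: bounded_terms_mono)
    then have bounded: "bounded_terms p (n * n + n + n + (p + N + 4)) (n * n + n + n + (p + N + 4)) (T n)"
      by (rule bounded_terms_mono) auto
    then have code: "equation_code p (poly_of_terms p (T n)) \<le> equation_code_bound (n * n + n + n + (p + N + 4))"
      by (intro equation_code_poly_of_terms_le) auto
    have "eval_poly (poly_of_terms p (T n)) xs = eval_terms (T n) ((!) xs)" for xs
      using bounded by (intro eval_poly_of_terms) (auto simp: bounded_terms_def)
    then have S: "?S = {xs. length xs = p \<and> eval_terms (T n) ((!) xs) = 0}"
      by (simp add: int_solutions_def)
    \<comment> \<open>Finite by finite-foldness. Its total bounds the unknowns of \<open>W\<close>;
      the first two unknowns are \<open>n\<close> and \<open>g n\<close>, the last two are at most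
      \<open>g n\<close>, and roots are bounded by their squares.\<close>
    define F where "F = nat_solutions m W [n, g n]"
    have "finite F" using fin by (simp add: F_def)
    define B where "B = n + g n + (\<Sum>ws\<in>F. sum_list ws)"
    have "set xs \<subseteq> {- int B..int B}" if "xs \<in> ?S" for xs
    proof -
      have xs: "length xs = p" "xs ! 0 = int n" "eval_terms (terms_of_poly W) ((!) xs) = 0"
        "xs ! 1 = xs ! (m + 2) + xs ! (m + 3)"
        "\<And>i. i < K \<Longrightarrow> xs ! i = (\<Sum>r<4. xs ! (K + 4 * i + r) * xs ! (K + 4 * i + r))"
        using that unfolding S T_0 by auto
      have nonneg: "xs ! i \<ge> 0" if "i < K" for i
        unfolding xs(5)[OF that] by (intro sum_nonneg) simp
      define ws where "ws = map (\<lambda>i. nat (xs ! (2 + i))) [0..<m]"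
      have prefix: "map int ([n, nat (xs ! 1)] @ ws) ! i = xs ! i" if i: "i < 2 + m" for i
      proof -
        consider "i = 0" | "i = 1" | j where "i = 2 + j" "j < m"
          using i by atomize_elim presburger
        then show ?thesis
          by cases (use xs(2) nonneg[of 1] nonneg[of i] in \<open>auto simp: ws_def K_def nth_append\<close>)
      qed
      \<comment> \<open>The initial part of \<open>xs\<close> is a natural solution of
        \<open>W\<close>, so the representation forces \<open>xs ! 1\<close> to be
        \<open>g n\<close>.\<close>
      have "eval_poly W (map int ([n, nat (xs ! 1)] @ ws)) = 0"
        using eval_terms_of_poly[OF W, of _ "(!) xs", OF prefix] xs(3) by simp
      then have ws: "ws \<in> nat_solutions m W [n, nat (xs ! 1)]"
        by (simp add: nat_solutions_def ws_def)
      then have "[n, nat (xs ! 1)] \<in> graph_pos g" using rep[of "[n, nat (xs ! 1)]"] by auto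
      then have gn: "nat (xs ! 1) = g n" by (auto simp: graph_pos_def)
      then have "ws \<in> F" using ws by (simp add: F_def)
      then have ws_le: "sum_list ws \<le> (\<Sum>ws\<in>F. sum_list ws)"
        using \<open>finite F\<close> by (intro member_le_sum) auto
      have B: "n \<le> B" "g n \<le> B" by (simp_all add: B_def)
      then have B1: "xs ! 1 \<le> int B" using gn by linarith
      have le_B: "xs ! i \<le> int B" if i: "i < K" for i
      proof -
        consider "i = 0" | "i = 1" | j where "i = 2 + j" "j < m" | "i = m + 2" | "i = m + 3"
          using i unfolding K_def
          by atomize_elim presburger
        then show ?thesis
        proof cases
          case 1
          then show ?thesis using xs(2) B by simp
        next
          case 2
          then show ?thesis using B1 by simp
        next
          case 3
          have "nat (xs ! i) = ws ! j" using 3 by (simp add: ws_def)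
          also have "\<dots> \<le> sum_list ws" using 3 by (intro member_le_sum_list) (auto simp: ws_def)
          also have "\<dots> \<le> B" using ws_le by (simp add: B_def)
          finally show ?thesis by simp
        next
          case 4
          then show ?thesis using B1 xs(4) nonneg[of "m + 3"] by (simp add: K_def)
        next
          case 5
          then show ?thesis using B1 xs(4) nonneg[of "m + 2"] by (simp add: K_def)
        qed
      qed
      have abs_le: "\<bar>xs ! i\<bar> \<le> int B" if "i < p" for i
      proof (cases "i < K")
        case True
        then show ?thesis using nonneg le_B by simp
      next
        case False
        \<comment> \<open>Position \<open>i\<close> holds root \<open>r\<close> of unknown
          \<open>j\<close>; its square is one of the nonnegative summands of
          \<open>xs ! j\<close>.\<close>
        define j r where "j = (i - K) div 4" and "r = (i - K) mod 4"
        have j: "j < K" "r < 4" "i = K + 4 * j + r" using False that by (auto simp: j_def r_def p_def)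
        have "\<bar>xs ! i\<bar> \<le> \<bar>xs ! i\<bar> * \<bar>xs ! i\<bar>"
          using mult_left_mono[of 1 "\<bar>xs ! i\<bar>" "\<bar>xs ! i\<bar>"] by (cases "xs ! i = 0") auto
        also have "\<dots> = xs ! (K + 4 * j + r) * xs ! (K + 4 * j + r)" by (simp add: j(3))
        also have "\<dots> \<le> (\<Sum>r<4. xs ! (K + 4 * j + r) * xs ! (K + 4 * j + r))"
          using j(2) by (intro member_le_sum) auto
        also have "\<dots> = xs ! j" using xs(5)[OF j(1)] by simp
        finally show ?thesis using le_B[OF j(1)] by simp
      qed
      show ?thesis
      proof
        fix x assume "x \<in> set xs"
        then obtain i where "i < p" "x = xs ! i" using xs(1) by (auto simp: in_set_conv_nth)
        then show "x \<in> {- int B..int B}" using abs_le[of i] by auto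
      qed
    qed
    then have "?S \<subseteq> {xs. set xs \<subseteq> {- int B..int B} \<and> length xs = p}" unfolding S by blast
    then have finite: "finite ?S" by (rule finite_subset) (simp add: finite_lists_length_eq)
    \<comment> \<open>One solution of \<open>W\<close> suffices, since the splittings of
      \<open>g n\<close> supply the multiplicity.\<close>
    obtain ws where ws: "ws \<in> F"
      using rep[of "[n, g n]"] n by (auto simp: graph_pos_def F_def)
    obtain q :: "nat \<Rightarrow> nat \<Rightarrow> int" where q: "\<And>v. int v = (\<Sum>r<4. q v r * q v r)"
      using four_squares_choice by blast
    define pre where "pre = [n, g n] @ ws"
    \<comment> \<open>With the roots chosen by \<open>q\<close>, a solution is determined by the
      first summand \<open>u\<close>, which is recovered from position \<open>m + 2\<close>.\<close>
    define z where "z u = pre @ [u, g n - u]" for u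
    define sol where "sol u = map int (z u) @ map (\<lambda>i. q (z u ! (i div 4)) (i mod 4)) [0..<4 * K]" for u
    have lenpre: "length pre = 2 + m" using ws by (simp add: pre_def F_def nat_solutions_def)
    then have lenz: "length (z u) = K" for u by (simp add: z_def K_def)
    have sol_nth: "sol u ! i = int (z u ! i)" if "i < K" for u i
      using that lenz by (simp add: sol_def nth_append)
    have sol_nth': "sol u ! (K + 4 * i + r) = q (z u ! i) r" if "i < K" "r < 4" for u i r
    proof -
      have "4 * i + r < 4 * K" "K + 4 * i + r = length (map int (z u)) + (4 * i + r)"
        using that lenz by auto
      then show ?thesis unfolding sol_def using that by (simp only: nth_append_length_plus) simp
    qed
    have z: "z u ! 0 = n" "z u ! 1 = g n" "z u ! (m + 2) = u" "z u ! (m + 3) = g n - u" for u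
      using lenpre by (simp_all add: z_def nth_append) (simp_all add: pre_def)
    have prefix: "map int pre ! i = sol u ! i" if "i < 2 + m" for u i
      using that lenpre by (simp add: sol_nth K_def z_def nth_append)
    have "sol u \<in> ?S" if "u \<le> g n" for u
    proof -
      have "length (sol u) = p" using lenz by (simp add: sol_def p_def)
      moreover have "eval_terms (terms_of_poly W) ((!) (sol u)) = eval_poly W (map int pre)"
        by (rule eval_terms_of_poly[OF W prefix])
      moreover have "eval_poly W (map int pre) = 0"
        using ws by (simp add: F_def nat_solutions_def pre_def)
      moreover have "sol u ! 0 = int n" "sol u ! 1 = sol u ! (m + 2) + sol u ! (m + 3)"
        using that sol_nth[of 0 u] sol_nth[of 1 u] sol_nth[of "m + 2" u] sol_nth[of "m + 3" u] z[of u]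
        by (simp_all add: K_def)
      moreover have "sol u ! i = (\<Sum>r<4. sol u ! (K + 4 * i + r) * sol u ! (K + 4 * i + r))" if "i < K" for i
        using that by (simp add: sol_nth sol_nth' q)
      ultimately show ?thesis
        unfolding S T_0 mem_Collect_eq by metis
    qed
    then have "sol ` {0..g n} \<subseteq> ?S" by auto
    moreover have "inj_on sol {0..g n}"
    proof (rule inj_onI)
      fix u v assume "sol u = sol v"
      then show "u = v" using sol_nth[of "m + 2" u] sol_nth[of "m + 2" v] z(3) by (simp add: K_def)
    qed
    \<comment> \<open>Including 0, \<open>u\<close> takes \<open>g n + 1\<close> values, whence the
      strict inequality.\<close>
    ultimately have "card {0..g n} \<le> card ?S" using finite by (metis card_image card_mono)
    then show ?thesis using finite code poly_in_poly_of_terms by auto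
  qed
  then show ?thesis using that by blast
qed

section \<open>The function obtained from the algorithm\<close>

text \<open>Allows the code of the algorithm's integer output to serve as a natural upper bound
  without decoding.\<close>

lemma le_int_encode: "b \<le> int (int_encode b)"
  by (auto simp: int_encode_def sum_encode_def)

theorem theorem2:
  assumes "\<exists>A. \<forall>p D. poly_in p D \<longrightarrow>
      (\<exists>b::int. rec_eval A [equation_code p D] (int_encode b) \<and>
         (finite (int_solutions p D) \<longrightarrow> b > int (card (int_solutions p D))))"
  shows "\<exists>g :: nat \<Rightarrow> nat.
      (\<forall>n>0. g n > 0) \<and> computable_pos g \<and> strict_mono_on {0<..} g \<and>
      (\<forall>n>0. max_solutions n \<le> g n) \<and>
      \<not> (\<exists>m W. finite_fold_diophantine_rep 2 (graph_pos g) m W)"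
proof -
  obtain A where A: "\<And>p D. poly_in p D \<Longrightarrow>
      \<exists>b::int. rec_eval A [equation_code p D] (int_encode b) \<and>
         (finite (int_solutions p D) \<longrightarrow> b > int (card (int_solutions p D)))"
    using assms by blast
  have "\<forall>c. \<exists>y. valid_code c \<longrightarrow> rec_eval A [c] y"
    using A unfolding valid_code_iff by blast
  then obtain a where a: "\<And>c. valid_code c \<Longrightarrow> rec_eval A [c] (a c)" by metis
  have card_less: "card (int_solutions p D) < a (equation_code p D)"
    if D: "poly_in p D" and fin: "finite (int_solutions p D)" for p D
  proof -
    obtain b where b: "rec_eval A [equation_code p D] (int_encode b)" "b > int (card (int_solutions p D))"
      using A[OF D] fin by blast
    have "valid_code (equation_code p D)" using D valid_code_iff by blast
    then have "a (equation_code p D) = int_encode b" using a b(1) rec_eval_deterministic by blast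
    then show ?thesis using b(2) le_int_encode[of b] by simp
  qed
  \<comment> \<open>Sending invalid codes to 0 makes every summand an actual output of
    \<open>A\<close>, which keeps the sum computable.\<close>
  define s where "s M = (\<Sum>c<Suc (equation_code_bound M). a (if valid_code c then c else 0))" for M
  \<comment> \<open>The sum \<open>s\<close> is merely monotone; the summand \<open>n\<close> makes
    \<open>g\<close> strictly increasing and positive.\<close>
  define g where "g n = n + s (27 * (n * n * n))" for n
  have s_mono: "s M \<le> s N" if "M \<le> N" for M N
    unfolding s_def using equation_code_bound_mono[OF that] by (intro sum_mono2) auto
  have a_le: "a (equation_code p D) \<le> s M" if "poly_in p D" "equation_code p D \<le> equation_code_bound M" for p D M
  proof -
    have "valid_code (equation_code p D)" using that valid_code_iff by blast
    then have "a (equation_code p D)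
        = (\<lambda>c. a (if valid_code c then c else 0)) (equation_code p D)" by simp
    also have "\<dots> \<le> s M"
      unfolding s_def using that(2) by (intro member_le_sum) auto
    finally show ?thesis .
  qed
  have "computable (Suc 0) (\<lambda>xs. g (hd xs))"
    unfolding g_def s_def by (rule computable_sum_valid_codes) (rule a)
  then have "computable_pos g"
    unfolding computable_def computable_pos_def by (metis length_0_conv length_Cons list.sel(1))
  moreover have "strict_mono_on {0<..} g"
  proof (rule strict_mono_onI)
    fix m n :: nat assume "m < n"
    then have "s (27 * (m * m * m)) \<le> s (27 * (n * n * n))"
      by (intro s_mono mult_le_mono) auto
    then show "g m < g n" using \<open>m < n\<close> by (simp add: g_def)
  qed
  moreover have "max_solutions n \<le> g n" if n: "n > 0" for n
    unfolding max_solutions_def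
  proof (rule Max.boundedI[OF finite_max_solutions_set nonempty_max_solutions_set])
    fix k assume "k \<in> {card (system_solutions n S) | S. S \<subseteq> E_sys n \<and> finite (system_solutions n S)}"
    then obtain S where S: "k = card (system_solutions n S)" "S \<subseteq> E_sys n" "finite (system_solutions n S)"
      by blast
    obtain D where "poly_in n D" "int_solutions n D = system_solutions n S"
      "equation_code n D \<le> equation_code_bound (27 * (n * n * n))"
      using subsystem_as_equation[OF S(2) n] .
    then show "k \<le> g n"
      using card_less[of n D] a_le[of n D] S by (fastforce simp: g_def)
  qed
  moreover have False if rep: "finite_fold_diophantine_rep 2 (graph_pos g) m W" for m W
  proof -
    obtain N where N: "\<And>n. n > 0 \<Longrightarrow> \<exists>p D. poly_in p D \<and> finite (int_solutions p D) \<and>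
        g n < card (int_solutions p D) \<and> equation_code p D \<le> equation_code_bound (n * n + n + n + N)"
      using equations_with_more_solutions_than_represented_value[OF rep] by blast
    \<comment> \<open>Since \<open>N < n\<close>, each summand of \<open>n * n + n + n + N\<close>
      is at most \<open>n * n * n\<close>, so the size is within the range covered by
      \<open>g n\<close>.\<close>
    define n where "n = N + 1"
    obtain p D where D: "poly_in p D" "finite (int_solutions p D)"
        "g n < card (int_solutions p D)" "equation_code p D \<le> equation_code_bound (n * n + n + n + N)"
      using N[of n] by (auto simp: n_def)
    have "n * n + n + n + N \<le> 27 * (n * n * n)" by (simp add: n_def algebra_simps)
    then have "s (n * n + n + n + N) \<le> g n" using s_mono by (simp add: g_def trans_le_add2)
    \<comment> \<open>The solution count exceeds \<open>g n\<close>, yet lies below an output of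
      \<open>A\<close> that is itself at most \<open>g n\<close>.\<close>
    then show False using a_le[OF D(1,4)] card_less[OF D(1,2)] D(3) by linarith
  qed
  ultimately show ?thesis
    by (intro exI[of _ g]) (auto simp: g_def)
qed

end
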